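(* For all positive integers $n$ and $k$, the Boolean lattice $\mathsf B_n$ with $n$ atoms has an at most $k$-element generating set if and only if $n\leq \mathrm{Sp}(k)$ or, equivalently, if and only if $\mathrm{LASp}(n)\leq k$. In particular, $\mathrm{LASp}(n)$ is the smallest possible size of a generating set of $\mathsf B_n$.
   Context: For a positive integer $n$, $\mathsf B_n=(\mathsf B_n;\vee,\wedge)$ denotes the Boolean lattice with $n$ atoms, considered as a lattice (the operations are binary join and binary meet only); it is isomorphic to the powerset lattice $(P(\{1,\dots,n\});\cup,\cap)$. A subset $X$ of $\mathsf B_n$ is a generating set of $\mathsf B_n$ if no proper subset of $\mathsf B_n$ that is closed with respect to $\vee$ and $\wedge$ includes $X$ as a subset. For a positive integer $k$, $\mathrm{Sp}(k):=\binom{k}{\lfloor k/2\rfloor}$. For a positive integer $n$, $\mathrm{LASp}(n)$ is the smallest positive integer $k$ such that $n\leq \mathrm{Sp}(k)$.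
   Formalization: The case n = k = 1 is excluded from the generating-set equivalences and n = 1 from the "in particular" clause: B_1 has two elements and every one-element subset is closed under join and meet, so it needs 2 generators although Sp(1) = LASp(1) = 1. *)

theory Defs
  imports Complex_Main
begin

(* The Boolean lattice with n atoms is represented by an arbitrary type of sort
   {boolean_algebra, finite} having exactly n atoms; for instance the type 'i set with
   'i :: finite and CARD('i) = n.  Only sup and inf take part in generation: bot, top
   and complementation are not operations. *)

definition lattice_atom :: "'a::order_bot \<Rightarrow> bool" where
  "lattice_atom a \<longleftrightarrow> a \<noteq> bot \<and> (\<forall>x. x \<le> a \<longrightarrow> x = bot \<or> x = a)"

definition closed_sup_inf :: "'a::lattice set \<Rightarrow> bool" where
  "closed_sup_inf S \<longleftrightarrow> (\<forall>x\<in>S. \<forall>y\<in>S. sup x y \<in> S \<and> inf x y \<in> S)"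

definition generating_set :: "'a::lattice set \<Rightarrow> bool" where
  "generating_set X \<longleftrightarrow> \<not> (\<exists>S. S \<subset> UNIV \<and> closed_sup_inf S \<and> X \<subseteq> S)"

definition Sp :: "nat \<Rightarrow> nat" where
  "Sp k = k choose (k div 2)"

definition LASp :: "nat \<Rightarrow> nat" where
  "LASp n = (LEAST k. 0 < k \<and> n \<le> Sp k)"

(* The case n = k = 1 has to be excluded when generating sets are compared with Sp and
   LASp: the two-element lattice is not generated by a single element, although
   Sp 1 = LASp 1 = 1. *)

lemma one_atom_not_one_generated:
  assumes "card {a :: 'a::{boolean_algebra, finite}. lattice_atom a} = 1"
  shows "\<not> (\<exists>X :: 'a set. generating_set X \<and> card X \<le> 1)"
proof
  assume "\<exists>X :: 'a set. generating_set X \<and> card X \<le> 1"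
  then obtain X :: "'a set" where X: "generating_set X" "card X \<le> 1" by blast
  obtain a :: 'a where a: "lattice_atom a"
    using assms by (metis (mono_tags, lifting) card_1_singletonE insertI1 mem_Collect_eq)
  have cl: "closed_sup_inf X"
    using X(2) by (auto simp: closed_sup_inf_def card_le_Suc0_iff_eq)
  have "X = UNIV"
    using X(1) cl unfolding generating_set_def by blast
  then have "a = bot"
    using X(2) by (simp add: card_le_Suc0_iff_eq)
  with a show False by (simp add: lattice_atom_def)
qed

lemma Sp_LASp_one: "Sp 1 = 1" "LASp 1 = 1"
proof -
  show *: "Sp 1 = 1" by (simp add: Sp_def)
  show "LASp 1 = 1" unfolding LASp_def by (rule Least_equality) (use * in auto)
qed

end

theory Submission
  imports Defs "HOL-Combinatorics.Multiset_Permutations"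
begin

text \<open>
  An atom \<open>a\<close> of the lattice is encoded by its trace \<open>{x \<in> X. a \<le> x}\<close> on a set \<open>X\<close>. If \<open>X\<close>
  generates, then the traces of distinct atoms are incomparable, because for atoms \<open>a \<noteq> b\<close> the set
  of all \<open>y\<close> with \<open>a \<le> y \<longrightarrow> b \<le> y\<close> is a proper sublattice; so Sperner's theorem bounds the number
  of atoms. Conversely, an injection of the atoms into the \<open>k div 2\<close>-element subsets of a \<open>k\<close>-element
  set prescribes the traces of the atoms on \<open>k\<close> elements, and the atoms and \<open>bot\<close> are recovered as
  meets of these elements.
\<close>

section \<open>Sperner's theorem\<close>

text \<open>Lubell's proof: a member \<open>S\<close> of the antichain is a prefix set of \<open>|S|! (|A| - |S|)!\<close> orderings
  of \<open>A\<close>, and no ordering has two different members as prefix sets.\<close>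

lemma card_permutations_with_prefix_ge:
  assumes "finite A" "S \<subseteq> A"
  shows "fact (card S) * fact (card A - card S)
    \<le> card {xs \<in> permutations_of_set A. set (take (card S) xs) = S}"
proof -
  let ?P = "permutations_of_set S \<times> permutations_of_set (A - S)"
  have fin: "finite S" using assms finite_subset by blast
  have len: "length xs = card S" if "xs \<in> permutations_of_set S" for xs
    using that by (metis length_finite_permutations_of_set)
  have inj: "inj_on (\<lambda>(xs, ys). xs @ ys) ?P"
    by (auto simp: inj_on_def len)
  have "fact (card S) * fact (card A - card S) = card ?P"
    using assms fin by (simp add: card_cartesian_product card_Diff_subset)
  also have "\<dots> = card ((\<lambda>(xs, ys). xs @ ys) ` ?P)"
    by (simp add: card_image[OF inj])
  also have "\<dots> \<le> card {xs \<in> permutations_of_set A. set (take (card S) xs) = S}"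
  proof (rule card_mono)
    show "(\<lambda>(xs, ys). xs @ ys) ` ?P
        \<subseteq> {xs \<in> permutations_of_set A. set (take (card S) xs) = S}"
    proof clarify
      fix xs ys assume xs: "xs \<in> permutations_of_set S" and ys: "ys \<in> permutations_of_set (A - S)"
      have "xs @ ys \<in> permutations_of_set A"
        using xs ys assms(2) by (auto simp: permutations_of_set_def)
      moreover have "set (take (card S) (xs @ ys)) = S"
        using xs by (simp add: len permutations_of_setD)
      ultimately show "xs @ ys \<in> permutations_of_set A \<and> set (take (card S) (xs @ ys)) = S" ..
    qed
  qed simp
  finally show ?thesis .
qed

theorem sperner:
  assumes "finite A" "F \<subseteq> Pow A"
    and antichain: "\<And>S T. S \<in> F \<Longrightarrow> T \<in> F \<Longrightarrow> S \<subseteq> T \<Longrightarrow> S = T"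
  shows "card F \<le> card A choose (card A div 2)"
proof -
  let ?n = "card A"
  let ?C = "?n choose (?n div 2)"
  let ?P = "\<lambda>S. {xs \<in> permutations_of_set A. set (take (card S) xs) = S}"
  have finF: "finite F" using assms(1,2) by (meson finite_Pow_iff finite_subset)
  \<comment> \<open>Two prefix sets of one ordering are nested, the shorter inside the longer, which
    an antichain forbids.\<close>
  have disj: "?P S \<inter> ?P T = {}" if ST: "S \<in> F" "T \<in> F" "S \<noteq> T" for S T
  proof (rule ccontr)
    assume "?P S \<inter> ?P T \<noteq> {}"
    then obtain xs where xs: "set (take (card S) xs) = S" "set (take (card T) xs) = T" by blast
    consider "card S \<le> card T" | "card T \<le> card S" by linarith
    then have "S \<subseteq> T \<or> T \<subseteq> S"
      by cases (metis xs set_take_subset_set_take)+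
    then show False using antichain ST by blast
  qed
  have "(\<Sum>S\<in>F. card (?P S)) = card (\<Union>S\<in>F. ?P S)"
    by (rule card_UN_disjoint[symmetric]) (use finF disj in auto)
  also have "\<dots> \<le> card (permutations_of_set A)"
    by (rule card_mono) auto
  finally have total: "(\<Sum>S\<in>F. card (?P S)) \<le> fact ?n"
    using assms(1) by simp
  \<comment> \<open>\<open>?C\<close> is the largest entry of its row, so each class
    \<open>?P S\<close> holds at least a \<open>1 / ?C\<close> share of all orderings; the shares of
    disjoint classes add up to at most 1.\<close>
  have each: "fact ?n \<le> ?C * card (?P S)" if "S \<in> F" for S
  proof -
    have S: "S \<subseteq> A" using that assms(2) by blast
    then have "card S \<le> ?n" using assms(1) by (simp add: card_mono)
    then have "fact ?n = (?n choose card S) * (fact (card S) * fact (?n - card S))"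
      by (metis binomial_fact_lemma mult.commute)
    also have "\<dots> \<le> ?C * card (?P S)"
      by (intro mult_mono binomial_maximum card_permutations_with_prefix_ge assms S) auto
    finally show ?thesis .
  qed
  have "card F * fact ?n = (\<Sum>S\<in>F. fact ?n)" by simp
  also have "\<dots> \<le> (\<Sum>S\<in>F. ?C * card (?P S))" by (rule sum_mono) (rule each)
  also have "\<dots> = ?C * (\<Sum>S\<in>F. card (?P S))" by (simp add: sum_distrib_left)
  also have "\<dots> \<le> ?C * fact ?n" using total by simp
  finally show ?thesis by simp
qed

section \<open>Atoms of Boolean lattices\<close>

text \<open>If \<open>a\<close> is below \<open>sup x y\<close>, distributivity makes it the join of
  \<open>inf a x\<close> and \<open>inf a y\<close>; each is \<open>bot\<close> or \<open>a\<close>,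
  so one of them is \<open>a\<close>.\<close>

lemma lattice_atom_le_sup_iff:
  fixes a :: "'a::boolean_algebra"
  assumes "lattice_atom a"
  shows "a \<le> sup x y \<longleftrightarrow> a \<le> x \<or> a \<le> y"
proof
  assume le: "a \<le> sup x y"
  have "inf a z = bot \<or> inf a z = a" for z
    using assms by (simp add: lattice_atom_def)
  moreover have "sup (inf a x) (inf a y) = a"
    using le by (metis inf.absorb1 inf_sup_distrib1)
  moreover have "a \<noteq> bot" using assms by (simp add: lattice_atom_def)
  ultimately have "inf a x = a \<or> inf a y = a" by (metis sup_bot.right_neutral)
  then show "a \<le> x \<or> a \<le> y" by (metis inf.cobounded2)
qed (auto intro: le_supI1 le_supI2)

lemma lattice_atom_le_atom:
  assumes "lattice_atom a" "lattice_atom b" "a \<le> b"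
  shows "a = b"
  using assms by (auto simp: lattice_atom_def)

lemma lattice_atom_below:
  fixes x :: "'a::{boolean_algebra, finite}"
  assumes "x \<noteq> bot"
  obtains a where "lattice_atom a" "a \<le> x"
proof -
  obtain a where a: "a \<noteq> bot" "a \<le> x" "\<forall>b. b \<noteq> bot \<longrightarrow> b \<le> a \<longrightarrow> a = b"
    using finite_has_minimal2[of "{y. y \<noteq> bot}" x] assms by auto
  then have "lattice_atom a" by (auto simp: lattice_atom_def)
  then show thesis using a that by blast
qed

lemma eq_if_same_atoms_below:
  fixes x y :: "'a::{boolean_algebra, finite}"
  assumes same: "\<And>a. lattice_atom a \<Longrightarrow> a \<le> x \<longleftrightarrow> a \<le> y"
  shows "x = y"
proof -
  have "u \<le> v" if *: "\<And>a. lattice_atom a \<Longrightarrow> a \<le> u \<Longrightarrow> a \<le> v" for u v :: 'a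
  proof (rule ccontr)
    assume "\<not> u \<le> v"
    \<comment> \<open>An atom below this element is below \<open>u\<close> but, being nonzero and
      below \<open>- v\<close>, not below \<open>v\<close>.\<close>
    then have "inf u (- v) \<noteq> bot" by (metis double_compl inf_shunt)
    then obtain a where a: "lattice_atom a" "a \<le> inf u (- v)" by (rule lattice_atom_below)
    then have "a \<le> v" using * by simp
    moreover have "a \<le> - v" using a(2) by simp
    ultimately have "a \<le> inf v (- v)" by (rule inf_greatest)
    then have "a = bot" by (simp add: bot_unique)
    with a show False by (simp add: lattice_atom_def)
  qed
  then show ?thesis using same by (meson order_antisym)
qed

text \<open>Closure gives binary meets only, hence \<open>I\<close> is nonempty: an empty meet would
  be a top element, which \<open>S\<close> may lack.\<close>

lemma closed_sup_inf_finite_Inf: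
  fixes f :: "'i \<Rightarrow> 'a::lattice"
  assumes "closed_sup_inf S" "finite I" "I \<noteq> {}" "f ` I \<subseteq> S"
  shows "\<exists>y\<in>S. \<forall>b. b \<le> y \<longleftrightarrow> (\<forall>i\<in>I. b \<le> f i)"
  using assms(2-4)
proof (induction I rule: finite_ne_induct)
  case (singleton i)
  then show ?case by auto
next
  case (insert i I)
  then obtain y where y: "y \<in> S" "\<And>b. b \<le> y \<longleftrightarrow> (\<forall>i\<in>I. b \<le> f i)" by auto
  then have "inf (f i) y \<in> S" using insert.prems assms(1) by (auto simp: closed_sup_inf_def)
  then show ?case using y(2) by (intro bexI[of _ "inf (f i) y"]) auto
qed

text \<open>Atoms are join-prime, so a join of atoms has no further atoms below it. The assumption
  on \<open>bot\<close> supplies the join of the empty family.\<close>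

lemma closed_sup_inf_join_of_atoms:
  fixes A :: "'a::boolean_algebra set"
  assumes "closed_sup_inf S" "bot \<in> S" "finite A" "A \<subseteq> S" "\<And>a. a \<in> A \<Longrightarrow> lattice_atom a"
  shows "\<exists>y\<in>S. \<forall>b. lattice_atom b \<longrightarrow> (b \<le> y \<longleftrightarrow> b \<in> A)"
  using assms(3-5)
proof (induction A rule: finite_induct)
  case empty
  then show ?case
    using assms(2) by (intro bexI[of _ bot]) (auto simp: lattice_atom_def bot_unique)
next
  case (insert a A)
  then obtain y where y: "y \<in> S" "\<forall>b. lattice_atom b \<longrightarrow> (b \<le> y \<longleftrightarrow> b \<in> A)" by auto
  have "sup a y \<in> S" using y insert.prems assms(1) by (auto simp: closed_sup_inf_def)
  moreover have "b \<le> sup a y \<longleftrightarrow> b \<in> insert a A" if b: "lattice_atom b" for b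
  proof -
    have "b \<le> a \<longleftrightarrow> b = a" using lattice_atom_le_atom[OF b] insert.prems by auto
    then show ?thesis using y b by (simp add: lattice_atom_le_sup_iff)
  qed
  ultimately show ?case by blast
qed

section \<open>Generating sets\<close>

lemma generating_set_iff:
  "generating_set X \<longleftrightarrow> (\<forall>S. closed_sup_inf S \<longrightarrow> X \<subseteq> S \<longrightarrow> S = UNIV)"
  by (auto simp: generating_set_def)

lemma generating_set_separates_atoms:
  fixes X :: "'a::boolean_algebra set"
  assumes "generating_set X" "lattice_atom a" "lattice_atom b"
    and sub: "{x \<in> X. a \<le> x} \<subseteq> {x \<in> X. b \<le> x}"
  shows "a = b"
proof -
  let ?S = "{y. a \<le> y \<longrightarrow> b \<le> y}"
  \<comment> \<open>Closure under \<open>sup\<close> rests on the join-primeness of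
    \<open>a\<close>.\<close>
  have "closed_sup_inf ?S"
    using assms(2,3) by (auto simp: closed_sup_inf_def lattice_atom_le_sup_iff)
  moreover have "X \<subseteq> ?S" using sub by blast
  ultimately have "?S = UNIV" using assms(1) by (simp add: generating_set_iff)
  then have "b \<le> a" by blast
  then show ?thesis using lattice_atom_le_atom assms by metis
qed

lemma card_atoms_le_Sp:
  fixes X :: "'a::{boolean_algebra, finite} set"
  assumes "generating_set X"
  shows "card {a :: 'a. lattice_atom a} \<le> Sp (card X)"
proof -
  let ?t = "\<lambda>a. {x \<in> X. a \<le> x}"
  have "inj_on ?t {a. lattice_atom a}"
    using generating_set_separates_atoms[OF assms] by (intro inj_onI) auto
  then have "card {a :: 'a. lattice_atom a} = card (?t ` {a. lattice_atom a})"
    by (simp add: card_image)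
  also have "\<dots> \<le> card X choose (card X div 2)"
  proof (rule sperner)
    fix S T assume "S \<in> ?t ` {a. lattice_atom a}" "T \<in> ?t ` {a. lattice_atom a}" "S \<subseteq> T"
    then obtain a b where "lattice_atom a" "S = ?t a" "lattice_atom b" "T = ?t b" by blast
    with \<open>S \<subseteq> T\<close> show "S = T" using generating_set_separates_atoms[OF assms] by metis
  qed auto
  finally show ?thesis by (simp add: Sp_def)
qed

text \<open>\<open>2 \<le> k\<close> puts \<open>k div 2\<close> strictly between 0 and
  \<open>k\<close>. The codes \<open>f a\<close> are then nonempty, so each atom is a meet of at
  least one generator, and proper, so the meet of all generators is \<open>bot\<close>.\<close>

lemma ex_generating_set:
  assumes "card {a :: 'a::{boolean_algebra, finite}. lattice_atom a} \<le> Sp k" "2 \<le> k"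
  shows "\<exists>X :: 'a set. generating_set X \<and> card X \<le> k"
proof -
  let ?A = "{a :: 'a. lattice_atom a}"
  let ?B = "{K. K \<subseteq> {..<k} \<and> card K = k div 2}"
  have cB: "card ?B = Sp k" by (simp add: n_subsets Sp_def)
  have "finite ?B" by (rule finite_subset[of _ "Pow {..<k}"]) auto
  then obtain f where f: "f ` ?A \<subseteq> ?B" "inj_on f ?A"
    using card_le_inj[of ?A ?B] assms(1) cB by (metis finite_code)
  have fB: "f a \<subseteq> {..<k}" "card (f a) = k div 2" if "lattice_atom a" for a
    using f(1) that by auto
  have f_anti: "a = b" if "lattice_atom a" "lattice_atom b" "f a \<subseteq> f b" for a b
  proof -
    have "f a = f b"
      using that fB[OF that(1)] fB[OF that(2)] by (intro card_subset_eq) (auto intro: finite_subset)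
    then show ?thesis using f(2) that by (auto dest: inj_onD)
  qed
  \<comment> \<open>The witness for \<open>i\<close> is the join of all atoms whose code contains
    \<open>i\<close>.\<close>
  have "\<exists>y :: 'a. \<forall>b. lattice_atom b \<longrightarrow> (b \<le> y \<longleftrightarrow> i \<in> f b)" for i
  proof -
    have "\<exists>y\<in>UNIV. \<forall>b :: 'a. lattice_atom b \<longrightarrow>
        (b \<le> y \<longleftrightarrow> b \<in> {a. lattice_atom a \<and> i \<in> f a})"
      by (rule closed_sup_inf_join_of_atoms) (simp_all add: closed_sup_inf_def)
    then show ?thesis by simp
  qed
  then obtain x :: "nat \<Rightarrow> 'a" where
    x: "\<And>i b. lattice_atom b \<Longrightarrow> b \<le> x i \<longleftrightarrow> i \<in> f b" by metis
  have "S = UNIV" if S: "closed_sup_inf S" "x ` {..<k} \<subseteq> S" for S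
  proof -
    \<comment> \<open>The witness is the meet of the \<open>x i\<close> with \<open>i\<close> in
      \<open>I\<close>. For \<open>I = f a\<close> the only atom below it is \<open>a\<close>, since
      codes are pairwise incomparable.\<close>
    have meet: "\<exists>y\<in>S. \<forall>b. lattice_atom b \<longrightarrow> (b \<le> y \<longleftrightarrow> I \<subseteq> f b)"
      if I: "I \<subseteq> {..<k}" "I \<noteq> {}" for I
    proof -
      obtain y where "y \<in> S" "\<And>b. b \<le> y \<longleftrightarrow> (\<forall>i\<in>I. b \<le> x i)"
        using closed_sup_inf_finite_Inf[OF S(1), of I x] I S(2)
        by (meson finite_lessThan finite_subset image_mono subset_trans)
      then show ?thesis using x by (intro bexI[of _ y]) auto
    qed
    have atoms: "a \<in> S" if a: "lattice_atom a" for a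
    proof -
      have "f a \<noteq> {}" using fB(2)[OF a] assms(2) by auto
      then obtain y where y: "y \<in> S" "\<forall>b. lattice_atom b \<longrightarrow> (b \<le> y \<longleftrightarrow> f a \<subseteq> f b)"
        using meet fB(1)[OF a] by blast
      have "y = a"
      proof (rule eq_if_same_atoms_below)
        fix b :: 'a assume b: "lattice_atom b"
        show "b \<le> y \<longleftrightarrow> b \<le> a"
          using y(2) a b f_anti[OF a b] lattice_atom_le_atom[OF b a] by auto
      qed
      with y show ?thesis by simp
    qed
    have "bot \<in> S"
    proof -
      obtain y where y: "y \<in> S" "\<forall>b. lattice_atom b \<longrightarrow> (b \<le> y \<longleftrightarrow> {..<k} \<subseteq> f b)"
        using meet[of "{..<k}"] assms(2) by (auto simp: lessThan_empty_iff)
      have "y = bot"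
      proof (rule ccontr)
        assume "y \<noteq> bot"
        then obtain b where b: "lattice_atom b" "b \<le> y" by (rule lattice_atom_below)
        then have "f b = {..<k}" using y(2) fB(1) by blast
        then show False using fB(2)[OF b(1)] assms(2) by simp
      qed
      with y show ?thesis by simp
    qed
    \<comment> \<open>\<open>z\<close> is the join of the atoms below it; for \<open>z = bot\<close>
      this family is empty.\<close>
    have "z \<in> S" for z
    proof -
      have "\<exists>y\<in>S. \<forall>b. lattice_atom b \<longrightarrow> (b \<le> y \<longleftrightarrow> b \<in> {b. lattice_atom b \<and> b \<le> z})"
        using S(1) \<open>bot \<in> S\<close> by (rule closed_sup_inf_join_of_atoms) (use atoms in simp_all, blast)
      then obtain y where "y \<in> S" "\<And>b. lattice_atom b \<Longrightarrow> b \<le> y \<longleftrightarrow> b \<le> z" by auto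
      then show ?thesis using eq_if_same_atoms_below[of y z] by simp
    qed
    then show ?thesis by blast
  qed
  then have "generating_set (x ` {..<k})" by (simp add: generating_set_iff)
  moreover have "card (x ` {..<k}) \<le> k" using card_image_le[of "{..<k}" x] by simp
  ultimately show ?thesis by blast
qed

section \<open>The functions Sp and LASp\<close>

text \<open>Keep the lower index \<open>k div 2\<close> while the row grows, then pass to the
  largest entry of the new row.\<close>

lemma Sp_mono: "mono Sp"
proof (rule mono_iff_le_Suc[THEN iffD2], rule allI)
  fix k
  have "Sp k \<le> Suc k choose (k div 2)" unfolding Sp_def by (rule binomial_right_mono) simp
  also have "\<dots> \<le> Sp (Suc k)" unfolding Sp_def by (rule binomial_maximum)
  finally show "Sp k \<le> Sp (Suc k)" .
qed

text \<open>The entry \<open>n choose 1\<close> is at most the largest of its row. For positive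
  \<open>n\<close> this makes \<open>n\<close> a candidate in the \<open>LEAST\<close> of
  \<open>LASp n\<close>, so the minimum is attained.\<close>

lemma le_Sp_self: "n \<le> Sp n"
  using binomial_maximum[of n 1] by (simp add: Sp_def)

text \<open>Monotonicity of \<open>Sp\<close> makes the \<open>k\<close> with
  \<open>n \<le> Sp k\<close> upward closed, and \<open>LASp n\<close> is the least positive
  one.\<close>

lemma LASp_le_iff:
  assumes "0 < n" "0 < k"
  shows "LASp n \<le> k \<longleftrightarrow> n \<le> Sp k"
proof
  have "n \<le> Sp (LASp n)"
    using LeastI[of "\<lambda>k. 0 < k \<and> n \<le> Sp k" n] assms le_Sp_self by (simp add: LASp_def)
  moreover assume "LASp n \<le> k"
  ultimately show "n \<le> Sp k" using monoD[OF Sp_mono] le_trans by blast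
qed (simp add: LASp_def Least_le assms)

theorem theorem2p1:
  fixes n k :: nat
  assumes "0 < n" and "0 < k"
    and "card {a :: 'a::{boolean_algebra, finite}. lattice_atom a} = n"
  shows "(\<not> (n = 1 \<and> k = 1) \<longrightarrow>
            ((\<exists>X :: 'a set. generating_set X \<and> card X \<le> k) \<longleftrightarrow> n \<le> Sp k) \<and>
            ((\<exists>X :: 'a set. generating_set X \<and> card X \<le> k) \<longleftrightarrow> LASp n \<le> k)) \<and>
         (n \<le> Sp k \<longleftrightarrow> LASp n \<le> k) \<and>
         (n \<noteq> 1 \<longrightarrow>
            (\<exists>X :: 'a set. generating_set X \<and> card X = LASp n) \<and>
            (\<forall>X :: 'a set. generating_set X \<longrightarrow> LASp n \<le> card X))"
proof -
  have lower: "n \<le> Sp (card X)" if "generating_set X" for X :: "'a set"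
    using card_atoms_le_Sp[OF that] assms(3) by simp
  have ex: "(\<exists>X :: 'a set. generating_set X \<and> card X \<le> m) \<longleftrightarrow> n \<le> Sp m"
    if "0 < m" "\<not> (n = 1 \<and> m = 1)" for m
  proof
    assume "\<exists>X :: 'a set. generating_set X \<and> card X \<le> m"
    then show "n \<le> Sp m" using lower monoD[OF Sp_mono] le_trans by blast
  next
    assume le: "n \<le> Sp m"
    \<comment> \<open>As \<open>Sp 1 = 1\<close>, \<open>m = 1\<close> would give the excluded pair
      \<open>n = m = 1\<close>; hence \<open>2 \<le> m\<close>, as the construction
      requires.\<close>
    then have "m \<noteq> 1" using that assms(1) by (auto simp: Sp_LASp_one(1)[simplified])
    then show "\<exists>X :: 'a set. generating_set X \<and> card X \<le> m"
      using ex_generating_set le assms(3) that(1) by (metis One_nat_def Suc_1 Suc_leI le_neq_implies_less)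
  qed
  have min: "LASp n \<le> card X" if X: "generating_set X" for X :: "'a set"
  proof -
    \<comment> \<open>The empty set is itself closed and proper, so it does not generate.\<close>
    have "X \<noteq> {}" using X by (auto simp: generating_set_iff closed_sup_inf_def)
    then have "0 < card X" by (simp add: card_gt_0_iff)
    then show ?thesis using LASp_le_iff assms(1) lower[OF X] by blast
  qed
  have "\<exists>X :: 'a set. generating_set X \<and> card X = LASp n" if "n \<noteq> 1"
  proof -
    have "0 < LASp n"
      using LeastI[of "\<lambda>k. 0 < k \<and> n \<le> Sp k" n] assms(1) le_Sp_self by (simp add: LASp_def)
    then have "\<exists>X :: 'a set. generating_set X \<and> card X \<le> LASp n"
      using ex[of "LASp n"] LASp_le_iff[of n "LASp n"] assms(1) that by simp
    \<comment> \<open>The lower bound \<open>min\<close> turns "at most" into equality.\<close>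
    then show ?thesis using min by (meson order_antisym)
  qed
  then show ?thesis using ex[OF assms(2)] LASp_le_iff[OF assms(1,2)] min by blast
qed

end
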